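(* For every $n\ge1$, every $A\in\mathrm{GL}(n,2)$, every $s\in\mathbb F_2^n$ and every phase angle $\varphi\in\mathbb R$, $$C_A^\dagger\,P_s(\varphi)\,C_A=P_{A^Ts}(\varphi).$$
   Context: $C_A$ is the $n$-qubit unitary permuting the computational basis by $C_A|x\rangle=|Ax\rangle$ for $x\in\mathbb F_2^n$. For $s\in\mathbb F_2^n$, $P_s(\varphi)=\sum_{x\in\mathbb F_2^n}e^{i\varphi(s\cdot x)}|x\rangle\langle x|$, where $s\cdot x\in\{0,1\}$ is the inner product over $\mathbb F_2$. *)

theory Defs
  imports "HOL-Analysis.Analysis" "HOL-Library.Z2"
begin

text \<open>
  The field with two elements is \<^typ>\<open>bit\<close>, so that \<open>bit ^ 'n\<close> is the space of column vectors
  of length \<open>CARD('n)\<close> over it. The computational basis of \<open>CARD('n)\<close> qubits is labelled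
  directly by these vectors: states have type \<open>complex ^ (bit ^ 'n)\<close>, of dimension
  \<open>2 ^ CARD('n)\<close>.
\<close>

instance bit :: finite
proof
  have "(UNIV :: bit set) \<subseteq> {0, 1}"
    by auto
  then show "finite (UNIV :: bit set)"
    by (rule finite_subset) simp
qed

type_synonym 'n state = "complex ^ (bit ^ 'n)"
type_synonym 'n operator = "complex ^ (bit ^ 'n) ^ (bit ^ 'n)"

definition conj_transpose :: "complex ^ 'a ^ 'b \<Rightarrow> complex ^ 'b ^ 'a"
  where "conj_transpose M = map_matrix cnj (transpose M)"

definition ket :: "bit ^ 'n::finite \<Rightarrow> 'n state"
  where "ket x = axis x 1"

text \<open>The operator \<open>|u\<rangle>\<langle>v|\<close>; conjugate-linear in \<open>v\<close>.\<close>

definition ketbra :: "'n::finite state \<Rightarrow> 'n state \<Rightarrow> 'n operator"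
  where "ketbra u v = (\<chi> i j. u $ i * cnj (v $ j))"

text \<open>
  \<open>C_A\<close> is the linear operator determined by \<open>|x\<rangle> \<mapsto> |A x\<rangle>\<close>; see \<open>linear_gate_ket\<close> and
  \<open>linear_gate_unique\<close> below. It is unitary when \<open>A\<close> is invertible.
\<close>

definition linear_gate :: "bit ^ 'n::finite ^ 'n \<Rightarrow> 'n operator"
  where "linear_gate A = (\<Sum>x\<in>UNIV. ketbra (ket (A *v x)) (ket x))"

text \<open>
  The exponent uses \<open>s \<cdot> x\<close> computed in \<^typ>\<open>bit\<close> and only then read as the number 0 or 1,
  by \<open>of_bit\<close>.
\<close>

definition parity_phase :: "bit ^ 'n::finite \<Rightarrow> real \<Rightarrow> 'n operator"
  where "parity_phase s \<phi> =
    (\<Sum>x\<in>UNIV. map_matrix ((*) (exp (\<i> * of_real (\<phi> * of_bit (scalar_product s x)))))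
       (ketbra (ket x) (ket x)))"

lemma linear_gate_nth: "linear_gate A $ i $ j = (if i = A *v j then 1 else 0)"
proof -
  have "linear_gate A $ i $ j = (\<Sum>x\<in>UNIV. if x = j then (if i = A *v j then 1 else 0) else 0)"
    unfolding linear_gate_def ketbra_def ket_def sum_component
    by (rule sum.cong) (auto simp: axis_def)
  then show ?thesis
    by simp
qed

lemma mult_ket_nth: "(M *v ket x) $ i = M $ i $ x"
  by (simp add: matrix_vector_mult_def ket_def axis_def if_distrib[of "(*) _"] cong: if_cong)

lemma linear_gate_ket: "linear_gate A *v ket x = ket (A *v x)"
  unfolding vec_eq_iff[where 'b = "bit ^ 'a"] mult_ket_nth linear_gate_nth
  by (simp add: ket_def axis_def)

lemma linear_gate_unique:
  assumes "\<And>x. M *v ket x = ket (A *v x)"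
  shows "M = linear_gate A"
proof -
  have "M $ i $ j = linear_gate A $ i $ j" for i j
    by (metis assms linear_gate_ket mult_ket_nth)
  then show ?thesis
    by (metis vec_eq_iff)
qed

lemma linear_gate_unitary:
  assumes "invertible A"
  shows "conj_transpose (linear_gate A) ** linear_gate A = mat 1"
    and "linear_gate A ** conj_transpose (linear_gate A) = mat 1"
proof -
  obtain B where B: "B ** A = mat 1"
    using assms by (auto simp: invertible_def)
  have inj: "A *v x = A *v y \<longleftrightarrow> x = y" for x y
    by (metis B matrix_vector_mul_assoc matrix_vector_mul_lid)
  have "(conj_transpose (linear_gate A) ** linear_gate A) $ i $ j = mat 1 $ i $ j" for i j
  proof -
    have "(conj_transpose (linear_gate A) ** linear_gate A) $ i $ j =
        (\<Sum>k\<in>UNIV. if k = A *v i then (if i = j then 1 else 0) else 0)"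
      unfolding matrix_matrix_mult_def conj_transpose_def transpose_def vec_lambda_beta
        nth_map_matrix linear_gate_nth
      by (rule sum.cong) (auto simp: inj)
    then show ?thesis
      by (simp add: mat_def)
  qed
  then show *: "conj_transpose (linear_gate A) ** linear_gate A = mat 1"
    by (metis vec_eq_iff)
  show "linear_gate A ** conj_transpose (linear_gate A) = mat 1"
    using * by (simp add: matrix_left_right_inverse)
qed

lemma parity_phase_ket:
  "parity_phase s \<phi> *v ket x = exp (\<i> * of_real (\<phi> * of_bit (scalar_product s x))) *s ket x"
proof -
  let ?e = "\<lambda>x. exp (\<i> * of_real (\<phi> * of_bit (scalar_product s x)))"
  have "(parity_phase s \<phi> *v ket x) $ i = (?e x *s ket x) $ i" for i
  proof -
    have "parity_phase s \<phi> $ i $ x = (\<Sum>y\<in>UNIV. if y = x then (if i = x then ?e x else 0) else 0)"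
      unfolding parity_phase_def ketbra_def ket_def sum_component
      by (rule sum.cong) (auto simp: axis_def)
    then show ?thesis
      by (simp add: mult_ket_nth) (simp add: ket_def axis_def)
  qed
  then show ?thesis
    by (metis vec_eq_iff)
qed

end

theory Submission
  imports Defs
begin

text \<open>
  Both sides are diagonal in the computational basis: \<open>P\<^sub>s\<close> multiplies \<open>C\<^sub>A |x\<rangle> = |A x\<rangle>\<close> by the
  phase of \<open>s \<cdot> A x = A\<^sup>T s \<cdot> x\<close>, and \<open>C\<^sub>A\<^sup>\<dagger>\<close> then undoes \<open>C\<^sub>A\<close> because \<open>C\<^sub>A\<close> is unitary.
\<close>

text \<open>Swapping the two finite sums moves \<open>A\<close> to the other argument as its
  transpose.\<close>

lemma scalar_product_matrix_vector_mult:
  fixes A :: "'a::comm_semiring_1 ^ 'm ^ 'n"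
  shows "scalar_product s (A *v x) = scalar_product (transpose A *v s) x"
proof -
  have "scalar_product s (A *v x) = (\<Sum>i\<in>UNIV. \<Sum>j\<in>UNIV. s $ i * (A $ i $ j * x $ j))"
    by (simp add: scalar_product_def matrix_vector_mult_def sum_distrib_left)
  also have "\<dots> = (\<Sum>j\<in>UNIV. \<Sum>i\<in>UNIV. s $ i * (A $ i $ j * x $ j))"
    by (rule sum.swap)
  also have "\<dots> = scalar_product (transpose A *v s) x"
    by (simp add: scalar_product_def matrix_vector_mult_def transpose_def sum_distrib_left ac_simps)
  finally show ?thesis .
qed

text \<open>\<open>M *v ket j\<close> is the \<open>j\<close>-th column of \<open>M\<close>, so the
  images of the basis kets fix every entry.\<close>

lemma operator_eqI_ket:
  assumes "\<And>x. M *v ket x = N *v ket x"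
  shows "M = N"
proof -
  have "M $ i $ j = N $ i $ j" for i j
    by (metis assms mult_ket_nth)
  then show ?thesis
    by (metis vec_eq_iff)
qed

theorem lemma1:
  fixes A :: "bit ^ 'n ^ 'n" and s :: "bit ^ 'n" and \<phi> :: real
  assumes "invertible A"
  shows "conj_transpose (linear_gate A) ** parity_phase s \<phi> ** linear_gate A
    = parity_phase (transpose A *v s) \<phi>"
proof (rule operator_eqI_ket)
  fix x :: "bit ^ 'n"
  let ?C = "linear_gate A"
  let ?e = "exp (\<i> * of_real (\<phi> * of_bit (scalar_product s (A *v x)))) :: complex"
  have "(conj_transpose ?C ** parity_phase s \<phi> ** ?C) *v ket x
      = conj_transpose ?C *v (parity_phase s \<phi> *v ket (A *v x))"
    by (simp only: matrix_vector_mul_assoc[symmetric] linear_gate_ket)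
  \<comment> \<open>The eigenvalue \<open>?e\<close> passes through by linearity; the ket is written
    as \<open>?C *v ket x\<close> again so that unitarity applies.\<close>
  also have "\<dots> = ?e *s (conj_transpose ?C *v (?C *v ket x))"
    by (simp only: parity_phase_ket vector_scalar_commute linear_gate_ket)
  also have "\<dots> = ?e *s ket x"
    by (simp add: matrix_vector_mul_assoc linear_gate_unitary(1)[OF assms])
  \<comment> \<open>The two parities agree already in \<open>bit\<close>, before
    \<open>of_bit\<close> is applied.\<close>
  also have "\<dots> = parity_phase (transpose A *v s) \<phi> *v ket x"
    by (simp only: parity_phase_ket scalar_product_matrix_vector_mult)
  finally show "(conj_transpose ?C ** parity_phase s \<phi> ** ?C) *v ket x
      = parity_phase (transpose A *v s) \<phi> *v ket x" .
qed

end
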